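(* Let $M\in\mathrm{M}_n(\mathbb{K})$ be a cyclic matrix with minimal polynomial $f=f_1^{m_1}\cdots f_s^{m_s}$, where $f_1,\dots,f_s\in\mathbb{K}[x]$ are pairwise distinct monic irreducible polynomials and $m_i\ge1$. Let $g\in\mathbb{L}[x]$ be a monic divisor of $f$, written $g=g_1\cdots g_s$ with $g_i\mid f_i^{m_i}$ in $\mathbb{L}[x]$. For each $i$ let $\ell_i=0$ if $g_i=1$, and $\ell_i=\min\{\ell\in\{1,\dots,m_i\} : g_i\mid f_i^{\ell}\}$ if $g_i\neq1$. Let $d=n-\sum_i\ell_i\deg f_i$ and let $v\in\mathbb{K}^n$ be a cyclic vector for $M$. Then: (1) $g\,\mathbb{L}[x]\cap\mathbb{K}[x]=\big(\prod_{i=1}^sf_i^{\ell_i}\big)\mathbb{K}[x]$; (2) the map $Q\in\mathbb{K}[x]_{<d}\mapsto v\,\big(\prod_i f_i^{\ell_i}\big)(M)^tQ(M)^t$ is a $\mathbb{K}$-linear isomorphism onto $\mathcal{C}_g\cap\mathbb{K}^n$; in particular $\dim_{\mathbb{K}}(\mathcal{C}_g\cap\mathbb{K}^n)=\sum_{i=1}^s(m_i-\ell_i)\deg f_i$; (3) if $\mathcal{C}_g\neq\{0\}$, then $M_1(\mathcal{C}_g)=1$ if and only if there exists $i$ with $\ell_i\le m_i-1$, i.e. with $g_i\mid f_i^{m_i-1}$.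
   Context: Let $\mathbb{L}/\mathbb{K}$ be a field extension of finite degree $m\ge n$. Vectors are row vectors; $\mathbb{F}[x]_{<d}$ denotes polynomials of degree $<d$. For $c=(c_1,\dots,c_n)\in\mathbb{L}^n$, $\mathrm{wt}_R(c)=\dim_{\mathbb{K}}\mathrm{Span}_{\mathbb{K}}(c_1,\dots,c_n)$, and for a nonzero linear code $\mathcal{C}\subseteq\mathbb{L}^n$, $M_1(\mathcal{C})=\min\{\mathrm{wt}_R(c):0\neq c\in\mathcal{C}\}$ (the first generalized rank weight). A matrix $M\in\mathrm{M}_n(\mathbb{K})$ is cyclic if there is $v\in\mathbb{K}^n$ (a cyclic vector) with $(v,vM^t,\dots,v(M^t)^{n-1})$ a basis; equivalently its minimal polynomial $f$ has degree $n$. For a monic divisor $g$ of $f$ in $\mathbb{L}[x]$, $\mathcal{C}_g=\{v\,g(M)^tP(M)^t : P\in\mathbb{L}[x]\}\subseteq\mathbb{L}^n$ (independent of the cyclic vector $v\in\mathbb{K}^n$, of dimension $n-\deg g$); every $\mathbb{L}$-subspace of $\mathbb{L}^n$ stable under $c\mapsto cM^t$ (an $M$-cyclic code) is $\mathcal{C}_g$ for a unique $g$, called its generator polynomial. *)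

theory Defs
  imports "HOL-Analysis.Analysis" "HOL-Computational_Algebra.Polynomial"
begin

text \<open>Field extension L/K, modelled by an injective field homomorphism emb : K \<rightarrow> L.\<close>
definition is_field_emb :: "('k::field \<Rightarrow> 'l::field) \<Rightarrow> bool" where
  "is_field_emb emb \<longleftrightarrow> inj emb \<and> emb 1 = 1 \<and>
     (\<forall>a b. emb (a + b) = emb a + emb b) \<and> (\<forall>a b. emb (a * b) = emb a * emb b)"

text \<open>L as a K-vector space.\<close>
definition ext_scale :: "('k::field \<Rightarrow> 'l::field) \<Rightarrow> 'k \<Rightarrow> 'l \<Rightarrow> 'l" where
  "ext_scale emb c x = emb c * x"

definition finite_degree :: "('k::field \<Rightarrow> 'l::field) \<Rightarrow> bool" where
  "finite_degree emb \<longleftrightarrow> (\<exists>B. finite B \<and> module.span (ext_scale emb) B = UNIV)"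

definition ext_degree :: "('k::field \<Rightarrow> 'l::field) \<Rightarrow> nat" where
  "ext_degree emb = vector_space.dim (ext_scale emb) (UNIV :: 'l set)"

text \<open>Matrix powers and polynomial evaluation at a square matrix.\<close>
primrec mat_pow :: "'a::comm_ring_1^'n^'n \<Rightarrow> nat \<Rightarrow> 'a^'n^'n" where
  "mat_pow A 0 = mat 1"
| "mat_pow A (Suc k) = A ** mat_pow A k"

definition poly_mat :: "'a::comm_ring_1 poly \<Rightarrow> 'a^'n^'n \<Rightarrow> 'a^'n^'n" where
  "poly_mat p A = (\<Sum>i\<le>degree p. mat (coeff p i) ** mat_pow A i)"

definition map_matrix :: "('a \<Rightarrow> 'b) \<Rightarrow> 'a^'n^'n \<Rightarrow> 'b^'n^'n" where
  "map_matrix h A = (\<chi> i j. h (A $ i $ j))"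

definition map_vector :: "('a \<Rightarrow> 'b) \<Rightarrow> 'a^'n \<Rightarrow> 'b^'n" where
  "map_vector h x = (\<chi> i. h (x $ i))"

text \<open>Cyclic vector: (v, v M^t, ..., v (M^t)^(n-1)) is a basis of K^n, n = CARD('n).
  Row vector v M^t corresponds to the column vector M *v v.\<close>
definition cyclic_vector :: "'k::field^'n^'n \<Rightarrow> 'k^'n \<Rightarrow> bool" where
  "cyclic_vector M v \<longleftrightarrow>
     (let B = (\<lambda>i. mat_pow M i *v v) ` {..<CARD('n)} in
       card B = CARD('n) \<and> vec.independent B \<and> vec.span B = UNIV)"

definition cyclic_matrix :: "'k::field^'n^'n \<Rightarrow> bool" where
  "cyclic_matrix M \<longleftrightarrow> (\<exists>v. cyclic_vector M v)"

definition is_min_poly :: "'k::field^'n^'n \<Rightarrow> 'k poly \<Rightarrow> bool" where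
  "is_min_poly M f \<longleftrightarrow> lead_coeff f = 1 \<and> poly_mat f M = 0 \<and>
     (\<forall>p. poly_mat p M = 0 \<longrightarrow> f dvd p)"

text \<open>The M-cyclic code C_g = { v g(M)^t P(M)^t : P in L[x] } (row vectors), written
  with column vectors as (P(M) g(M)) v, for the cyclic vector v in K^n.\<close>
definition cyclic_code ::
  "('k::field \<Rightarrow> 'l::field) \<Rightarrow> 'k^'n^'n \<Rightarrow> 'k^'n \<Rightarrow> 'l poly \<Rightarrow> ('l^'n) set" where
  "cyclic_code emb M v g =
     {(poly_mat P (map_matrix emb M) ** poly_mat g (map_matrix emb M)) *v map_vector emb v
       | P. True}"

text \<open>Rank weight: K-dimension of the K-span of the entries.\<close>
definition rank_weight :: "('k::field \<Rightarrow> 'l::field) \<Rightarrow> 'l^'n \<Rightarrow> nat" where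
  "rank_weight emb c =
     vector_space.dim (ext_scale emb) (module.span (ext_scale emb) (range (\<lambda>i. c $ i)))"

definition first_gen_rank_weight :: "('k::field \<Rightarrow> 'l::field) \<Rightarrow> ('l^'n) set \<Rightarrow> nat" where
  "first_gen_rank_weight emb C = Min {rank_weight emb c | c. c \<in> C \<and> c \<noteq> 0}"

end

theory Submission
  imports Defs
begin

(* Distinct monic irreducible f_i are pairwise comaximal in K[x]; hence so are their powers and, in
   L[x], the divisors g_i of their images.  Writing h = f_i^k r with f_i not dividing r, the image of
   r is comaximal with g_i | f_i^(m_i), so g_i divides h iff it divides f_i^k, i.e. iff l_i <= k.
   Thus g divides h in L[x] iff F = prod f_i^(l_i) divides h in K[x], which is (1).

   The Krylov basis v, Mv, ..., M^(n-1) v stays a basis of L^n, so v is a cyclic vector of M over L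
   as well and its annihilator in L[x] is generated by f.  A vector w = h(M) v of K^n (deg h < n)
   therefore lies in C_g iff g divides h in L[x], iff F divides h.  So C_g \<inter> K^n is the image of
   K[x]_{<n - deg F} under the injective linear map Q \<mapsto> (Q F)(M) v, giving (2).

   A nonzero word has rank weight 1 iff it is an L-multiple of a nonzero vector of K^n.  As C_g is
   an L-subspace, M_1(C_g) = 1 iff C_g \<inter> K^n \<noteq> 0, iff deg F < n, iff l_i < m_i for some i. *)


section \<open>Comaximal elements\<close>

text \<open>Bezout-style coprimality.  For an arbitrary field \<open>K\<close> the library provides no gcd on
  \<open>K[x]\<close>, so the ring-theoretic arguments below use this notion instead of \<^const>\<open>coprime\<close>.\<close>

definition comaximal :: "'a::comm_ring_1 \<Rightarrow> 'a \<Rightarrow> bool" where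
  "comaximal a b \<longleftrightarrow> (\<exists>u w. u * a + w * b = 1)"

lemma comaximal_commute: "comaximal a b \<longleftrightarrow> comaximal b a"
  unfolding comaximal_def by (metis add.commute)

lemma comaximal_1_left: "comaximal 1 b"
  unfolding comaximal_def by (metis add_0_right mult_1 mult_zero_left)

lemma comaximal_mult_left:
  assumes "comaximal a b" "comaximal a' b" shows "comaximal (a * a') b"
proof -
  obtain u w where uw: "u * a + w * b = 1" using assms(1) comaximal_def by blast
  obtain u' w' where uw': "u' * a' + w' * b = 1" using assms(2) comaximal_def by blast
  have "(u * u') * (a * a') + (u * a * w' + w * (u' * a' + w' * b)) * b
        = (u * a + w * b) * (u' * a' + w' * b)"
    by (simp add: algebra_simps)
  also have "\<dots> = 1" by (simp add: uw uw')
  finally show ?thesis unfolding comaximal_def by blast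
qed

lemma comaximal_prod_left:
  "(\<And>i. i \<in> A \<Longrightarrow> comaximal (f i) b) \<Longrightarrow> comaximal (\<Prod>i\<in>A. f i) b"
  by (induction A rule: infinite_finite_induct) (auto simp: comaximal_1_left comaximal_mult_left)

lemma comaximal_power_left: "comaximal a b \<Longrightarrow> comaximal (a ^ m) b"
  using comaximal_prod_left[of "{..<m}" "\<lambda>_. a" b] by simp

lemma comaximal_power: "comaximal a b \<Longrightarrow> comaximal (a ^ m) (b ^ k)"
  by (metis comaximal_commute comaximal_power_left)

lemma comaximal_divisors:
  assumes "comaximal a b" "a' dvd a" "b' dvd b" shows "comaximal a' b'"
proof -
  obtain u w where uw: "u * a + w * b = 1" using assms(1) comaximal_def by blast
  obtain k j where "a = a' * k" "b = b' * j" using assms(2,3) by (elim dvdE)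
  with uw have "(u * k) * a' + (w * j) * b' = 1" by (simp add: algebra_simps)
  thus ?thesis unfolding comaximal_def by blast
qed

lemma comaximal_dvd_mult_right:
  assumes "comaximal a c" "a dvd b * c" shows "a dvd b"
proof -
  obtain u w where uw: "u * a + w * c = 1" using assms(1) comaximal_def by blast
  have "b = (u * b) * a + w * (b * c)"
    using uw by (metis mult.commute mult.left_commute mult_1 distrib_left)
  also have "a dvd \<dots>" using assms(2) by simp
  finally show ?thesis .
qed

lemma comaximal_mult_dvd:
  assumes "comaximal a b" "a dvd x" "b dvd x" shows "a * b dvd x"
proof -
  obtain u w where uw: "u * a + w * b = 1" using assms(1) comaximal_def by blast
  obtain y z where "x = a * y" "x = b * z" using assms(2,3) by (elim dvdE)
  hence "x = (a * b) * (u * z + w * y)"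
    by (metis (no_types, lifting) uw distrib_left distrib_right mult.assoc mult.left_commute mult_1)
  thus ?thesis by (rule dvdI)
qed

lemma prod_dvd_iff_pairwise_comaximal:
  fixes a :: "nat \<Rightarrow> 'a::comm_ring_1"
  assumes "\<And>i j. i < s \<Longrightarrow> j < s \<Longrightarrow> i \<noteq> j \<Longrightarrow> comaximal (a i) (a j)"
  shows "(\<Prod>i<s. a i) dvd x \<longleftrightarrow> (\<forall>i<s. a i dvd x)"
  using assms
proof (induction s)
  case (Suc s)
  have "comaximal (\<Prod>i<s. a i) (a s)"
    by (rule comaximal_prod_left) (use Suc.prems in auto)
  with Suc show ?case
    by (auto simp: less_Suc_eq intro: comaximal_mult_dvd dvd_mult_left dvd_mult_right)
qed simp

lemma comaximal_hom:
  assumes "\<And>x y. h (x + y) = h x + h y" "\<And>x y. h (x * y) = h x * h y" "h 1 = 1"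
    and "comaximal a b"
  shows "comaximal (h a) (h b)"
  using assms unfolding comaximal_def by metis

section \<open>Polynomials over a field\<close>

lemma coprime_imp_comaximal_poly:
  fixes a b :: "'a::field poly"
  assumes "coprime a b"
  shows "comaximal a b"
proof -
  define I where "I = {u * a + w * b | u w. True}"
  have aI: "a \<in> I" unfolding I_def by (rule CollectI, rule exI[of _ 1], rule exI[of _ 0]) simp
  have bI: "b \<in> I" unfolding I_def by (rule CollectI, rule exI[of _ 0], rule exI[of _ 1]) simp
  have "a \<noteq> 0 \<or> b \<noteq> 0" using assms by auto
  then obtain e where "e \<in> I" "e \<noteq> 0" using aI bI by blast
  then obtain d where d: "d \<in> I" "d \<noteq> 0"
    and dmin: "\<And>e. e \<in> I \<Longrightarrow> e \<noteq> 0 \<Longrightarrow> degree d \<le> degree e"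
    using ex_has_least_nat[of "\<lambda>e. e \<in> I \<and> e \<noteq> 0" e degree] by blast
  obtain u' w' where dd: "d = u' * a + w' * b" using d I_def by blast
  have dvdI: "d dvd x" if "x \<in> I" for x
  proof -
    obtain u w where x: "x = u * a + w * b" using \<open>x \<in> I\<close> I_def by blast
    have "x mod d = (u - x div d * u') * a + (w - x div d * w') * b"
      by (simp add: x dd minus_div_mult_eq_mod[symmetric] algebra_simps)
    hence "x mod d \<in> I" unfolding I_def by blast
    hence "x mod d = 0" using dmin degree_mod_less[OF d(2), of x] by (meson not_le)
    thus ?thesis by (simp add: mod_eq_0_iff_dvd)
  qed
  have "is_unit d" using coprime_common_divisor[OF assms] aI bI dvdI by blast
  then obtain e where e: "1 = d * e" by (elim dvdE)
  have "(e * u') * a + (e * w') * b = 1" using e dd by (simp add: algebra_simps)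
  thus ?thesis unfolding comaximal_def by blast
qed

lemma irreducible_not_dvd_imp_coprime:
  assumes "irreducible p" "\<not> p dvd r"
  shows "coprime p r"
proof (rule coprimeI)
  fix c assume c: "c dvd p" "c dvd r"
  then obtain e where e: "p = c * e" by (elim dvdE)
  from irreducibleD[OF assms(1) e] show "is_unit c"
  proof
    assume "is_unit e"
    hence "p dvd c" using e by (simp add: mult_unit_dvd_iff)
    with c assms(2) show ?thesis using dvd_trans by blast
  qed
qed

lemma irreducible_degree_pos:
  fixes p :: "'a::field poly"
  assumes "irreducible p" shows "0 < degree p"
  using assms is_unit_iff_degree by (auto simp: irreducible_def)

lemma monic_unit_eq_1:
  fixes q :: "'a::field poly"
  assumes "lead_coeff q = 1" "is_unit q" shows "q = 1"
  using is_unit_monom_trivial[OF assms(2)] assms(1) by (simp add: monom_0 one_pCons)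

lemma monic_irreducible_dvd_imp_eq:
  fixes p q :: "'a::field poly"
  assumes "irreducible p" "irreducible q" "lead_coeff p = 1" "lead_coeff q = 1" "p dvd q"
  shows "p = q"
proof -
  obtain e where e: "q = p * e" using assms(5) by (elim dvdE)
  have "is_unit e" using irreducibleD[OF assms(2) e] assms(1) by (auto simp: irreducible_def)
  moreover have "lead_coeff e = 1" using assms(3,4) unfolding e lead_coeff_mult by simp
  ultimately have "e = 1" by (rule monic_unit_eq_1[rotated])
  thus ?thesis using e by simp
qed

lemma irreducible_power_cofactorE:
  fixes p h :: "'a::field poly"
  assumes "irreducible p" "h \<noteq> 0"
  obtains k r where "h = p ^ k * r" "\<not> p dvd r"
  using assms(2)
proof (induction "degree h" arbitrary: h thesis rule: less_induct)
  case less
  show ?case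
  proof (cases "p dvd h")
    case True
    then obtain h' where h': "h = p * h'" by (elim dvdE)
    have "degree h' < degree h"
      using h' less.prems(2) irreducible_degree_pos[OF assms(1)] by (auto simp: degree_mult_eq)
    moreover have "h' \<noteq> 0" using h' less.prems(2) by auto
    ultimately obtain k r where "h' = p ^ k * r" "\<not> p dvd r" using less.hyps by metis
    with h' show ?thesis by (intro less.prems(1)[of "Suc k" r]) (simp_all add: mult.assoc)
  qed (use less.prems(1)[of 0 h] in simp)
qed

lemma least_exponent_dvd_power:
  fixes q r :: "'a::field poly"
  assumes monic: "lead_coeff q = 1" and dvd_m: "q dvd r ^ m" and m: "1 \<le> m"
    and l: "l = (if q = 1 then 0 else LEAST k. 1 \<le> k \<and> k \<le> m \<and> q dvd r ^ k)"
  shows "l \<le> m" and "q dvd r ^ l" and "\<And>k. q dvd r ^ k \<Longrightarrow> l \<le> k"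
proof -
  let ?P = "\<lambda>k. 1 \<le> k \<and> k \<le> m \<and> q dvd r ^ k"
  have "?P (LEAST k. ?P k)" using m dvd_m by (intro LeastI[of ?P m]) simp
  thus "l \<le> m" and "q dvd r ^ l" using l by auto
  show "l \<le> k" if "q dvd r ^ k" for k
  proof (cases "q = 1")
    case False
    have "k \<noteq> 0" using that False monic_unit_eq_1[OF monic] by (cases k) auto
    hence "?P (min k m)" using that dvd_m m by (cases "k \<le> m") (simp_all add: min_def)
    hence "(LEAST k. ?P k) \<le> min k m" by (rule Least_le)
    thus ?thesis using l False by simp
  qed (use l in simp)
qed

lemma degree_prod_powers:
  fixes p :: "'b \<Rightarrow> 'a::idom poly"
  assumes "\<And>i. i \<in> A \<Longrightarrow> p i \<noteq> 0"
  shows "degree (\<Prod>i\<in>A. p i ^ e i) = (\<Sum>i\<in>A. e i * degree (p i))"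
  using assms by (simp add: degree_prod_eq_sum_degree degree_power_eq)

lemma sum_diff_mult_nat:
  fixes m l c :: "'a \<Rightarrow> nat"
  assumes "\<And>i. i \<in> A \<Longrightarrow> l i \<le> m i"
  shows "(\<Sum>i\<in>A. (m i - l i) * c i) = (\<Sum>i\<in>A. m i * c i) - (\<Sum>i\<in>A. l i * c i)"
  unfolding diff_mult_distrib using assms by (intro sum_subtractf_nat) (simp add: mult_le_mono1)

lemma sum_diff_mult_pos_iff:
  fixes m l c :: "'a \<Rightarrow> nat"
  assumes "finite A" "\<And>i. i \<in> A \<Longrightarrow> 0 < c i"
  shows "0 < (\<Sum>i\<in>A. (m i - l i) * c i) \<longleftrightarrow> (\<exists>i\<in>A. l i < m i)"
  using assms by (auto simp: not_le simp flip: neq0_conv)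

section \<open>Polynomials as a vector space\<close>

global_interpretation poly_vs: vector_space "smult :: 'a::field \<Rightarrow> 'a poly \<Rightarrow> 'a poly"
  by unfold_locales (simp_all add: smult_add_right smult_add_left)

lemma poly_vs_span_monoms:
  "poly_vs.span (monom 1 ` {..<d}) = {Q :: 'a::field poly. Q = 0 \<or> degree Q < d}" (is "_ = ?D")
proof
  have "poly_vs.subspace ?D"
    unfolding poly_vs.subspace_def by (auto intro: degree_add_less)
  moreover have "monom 1 ` {..<d} \<subseteq> ?D" by (auto simp: degree_monom_eq)
  ultimately show "poly_vs.span (monom 1 ` {..<d}) \<subseteq> ?D" by (simp add: poly_vs.span_minimal)
next
  show "?D \<subseteq> poly_vs.span (monom 1 ` {..<d})"
  proof
    fix Q assume "Q \<in> ?D"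
    hence "Q = (\<Sum>i<d. smult (coeff Q i) (monom 1 i))"
      by (intro poly_eqI)
        (auto simp: coeff_sum coeff_monom if_distrib sum.delta coeff_eq_0 cong: if_cong)
    also have "\<dots> \<in> poly_vs.span (monom 1 ` {..<d})"
      by (intro poly_vs.span_sum poly_vs.span_scale poly_vs.span_base imageI) simp
    finally show "Q \<in> poly_vs.span (monom 1 ` {..<d})" .
  qed
qed

lemma poly_vs_independent_monoms: "poly_vs.independent (monom (1 :: 'a::field) ` {..<d})"
  (is "poly_vs.independent ?M")
proof (rule poly_vs.independent_if_scalars_zero)
  fix u m
  assume sum: "(\<Sum>x\<in>?M. smult (u x) x) = 0" and m: "m \<in> ?M"
  then obtain j where j: "j < d" "m = monom 1 j" by blast
  have "coeff (\<Sum>x\<in>?M. smult (u x) x) j = u m"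
    using j by (simp add: sum.reindex inj_on_def monom_eq_iff' coeff_sum coeff_monom if_distrib
        sum.delta cong: if_cong)
  thus "u m = 0" using sum by simp
qed simp

lemma ex_nonzero_degree_less_iff:
  "(\<exists>Q\<in>{Q. Q = 0 \<or> degree Q < d}. (Q :: 'a::comm_semiring_1 poly) \<noteq> 0) \<longleftrightarrow> 0 < d"
  (is "?L \<longleftrightarrow> _")
proof
  assume "0 < d"
  thus ?L by (intro bexI[of _ 1]) simp_all
qed auto

lemma inj_on_image_ex_nonzero_iff:
  assumes "inj_on f A" "0 \<in> A" "f 0 = 0"
  shows "(\<exists>y\<in>f ` A. y \<noteq> 0) \<longleftrightarrow> (\<exists>x\<in>A. x \<noteq> 0)"
proof
  assume "\<exists>x\<in>A. x \<noteq> 0"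
  then obtain x where "x \<in> A" "x \<noteq> 0" by blast
  hence "f x \<noteq> f 0" using inj_onD[OF assms(1) _ _ assms(2)] by blast
  thus "\<exists>y\<in>f ` A. y \<noteq> 0" using \<open>x \<in> A\<close> assms(3) by auto
next
  assume "\<exists>y\<in>f ` A. y \<noteq> 0"
  then obtain x where "x \<in> A" "f x \<noteq> 0" by blast
  moreover have "x \<noteq> 0" using \<open>f x \<noteq> 0\<close> assms(3) by auto
  ultimately show "\<exists>x\<in>A. x \<noteq> 0" by blast
qed

lemma dim_image_degree_less:
  fixes \<phi> :: "'a::field poly \<Rightarrow> 'a^'n"
  assumes lin: "Vector_Spaces.linear smult (*s) \<phi>"
    and inj: "inj_on \<phi> {Q. Q = 0 \<or> degree Q < d}"
  shows "vec.dim (\<phi> ` {Q. Q = 0 \<or> degree Q < d}) = d"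
proof -
  interpret \<phi>: Vector_Spaces.linear smult "(*s)" \<phi> by (fact lin)
  have inj_span: "inj_on \<phi> (poly_vs.span (monom 1 ` {..<d}))"
    using inj by (simp add: poly_vs_span_monoms)
  have "vec.dim (\<phi> ` poly_vs.span (monom 1 ` {..<d}))
      = vec.dim (vec.span (\<phi> ` monom 1 ` {..<d}))"
    by (simp add: \<phi>.span_image)
  also have "\<dots> = card (\<phi> ` monom 1 ` {..<d})"
    using \<phi>.independent_injective_image[OF poly_vs_independent_monoms inj_span]
    by (rule vec.dim_span_eq_card_independent)
  also have "\<dots> = d"
    using inj_on_subset[OF inj_span poly_vs.span_superset]
    by (simp add: card_image inj_on_def monom_eq_iff')
  finally show ?thesis by (simp add: poly_vs_span_monoms)
qed

section \<open>Polynomials evaluated at a matrix\<close>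

lemma mat_add: "(mat (a + b) :: 'a::semiring_1^'n^'n) = mat a + mat b"
  by (simp add: vec_eq_iff mat_def)

lemma mat_mult_nth: "(mat c ** X) $ i $ j = c * X $ i $ j"
  for X :: "'a::semiring_1^'m^'n"
  by (simp add: matrix_matrix_mult_def mat_def if_distrib if_distribR sum.delta cong: if_cong)

lemma mult_mat_nth: "(X ** mat c) $ i $ j = X $ i $ j * c"
  for X :: "'a::semiring_1^'m^'n"
  by (simp add: matrix_matrix_mult_def mat_def if_distrib if_distribR sum.delta' cong: if_cong)

lemma mat_mult_mat: "mat a ** mat b = (mat (a * b) :: 'a::semiring_1^'n^'n)"
  by (simp add: vec_eq_iff mat_mult_nth) (simp add: mat_def)

lemma mat_mult_left_commute: "mat c ** (A ** B) = A ** (mat c ** B)"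
  for A B :: "'a::comm_semiring_1^'n^'n"
proof -
  have "mat c ** A = A ** mat c" by (simp add: vec_eq_iff mat_mult_nth mult_mat_nth mult.commute)
  thus ?thesis by (metis matrix_mul_assoc)
qed

lemma matrix_vector_mult_mat: "mat c *v x = c *s x"
  for x :: "'a::semiring_1^'n"
  by (simp add: vec_eq_iff matrix_vector_mult_def mat_def if_distrib if_distribR sum.delta
      cong: if_cong)

lemma matrix_add_rdistrib: "(A + B) ** C = A ** C + B ** C"
  for A B :: "'a::semiring_1^'m^'n"
  by (vector matrix_matrix_mult_def sum.distrib[symmetric] field_simps)

lemma matrix_mul_sum_right: "C ** (\<Sum>i\<in>S. f i) = (\<Sum>i\<in>S. C ** f i)"
  for f :: "'b \<Rightarrow> 'a::semiring_1^'m^'n"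
  by (induction S rule: infinite_finite_induct) (auto simp: matrix_add_ldistrib)

lemma matrix_vector_mult_sum_left: "(\<Sum>i\<in>S. f i) *v x = (\<Sum>i\<in>S. f i *v x)"
  for f :: "'b \<Rightarrow> 'a::semiring_1^'m^'n"
  by (induction S rule: infinite_finite_induct) (auto simp: matrix_vector_mult_add_rdistrib)

lemma poly_mat_eq_sum:
  fixes A :: "'a::comm_ring_1^'n^'n"
  assumes "degree p < N"
  shows "poly_mat p A = (\<Sum>i<N. mat (coeff p i) ** mat_pow A i)"
proof -
  have "poly_mat p A = (\<Sum>i<Suc (degree p). mat (coeff p i) ** mat_pow A i)"
    unfolding poly_mat_def by (simp add: lessThan_Suc_atMost)
  also have "\<dots> = (\<Sum>i<N. mat (coeff p i) ** mat_pow A i)"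
    by (rule sum.mono_neutral_left) (use assms in \<open>auto simp: coeff_eq_0\<close>)
  finally show ?thesis .
qed

lemma poly_mat_0 [simp]: "poly_mat 0 A = 0"
  by (simp add: poly_mat_def)

lemma poly_mat_add: "poly_mat (p + q) A = poly_mat p A + poly_mat q A"
proof -
  define N where "N = Suc (max (degree p) (degree q))"
  have "degree (p + q) < N" "degree p < N" "degree q < N"
    unfolding N_def using degree_add_le_max[of p q] by auto
  thus ?thesis by (simp add: poly_mat_eq_sum mat_add matrix_add_rdistrib sum.distrib)
qed

lemma poly_mat_diff: "poly_mat (p - q) A = poly_mat p A - poly_mat q A"
  by (metis add_diff_cancel poly_mat_add diff_add_cancel)

lemma poly_mat_smult: "poly_mat (smult c p) A = mat c ** poly_mat p A"
proof -
  have N: "degree (smult c p) < Suc (degree p)" "degree p < Suc (degree p)"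
    using degree_smult_le[of c p] by auto
  show ?thesis
    unfolding poly_mat_eq_sum[OF N(1)] poly_mat_eq_sum[OF N(2)] matrix_mul_sum_right coeff_smult
    by (simp only: matrix_mul_assoc mat_mult_mat)
qed

lemma poly_mat_pCons: "poly_mat (pCons a p) A = mat a + A ** poly_mat p A"
proof -
  define N where "N = Suc (degree p)"
  have N: "degree (pCons a p) < Suc N" "degree p < N"
    unfolding N_def using degree_pCons_le[of a p] by auto
  have "poly_mat (pCons a p) A = mat a + (\<Sum>i<N. mat (coeff p i) ** (A ** mat_pow A i))"
    unfolding poly_mat_eq_sum[OF N(1)] sum.lessThan_Suc_shift by simp
  also have "\<dots> = mat a + A ** poly_mat p A"
    unfolding poly_mat_eq_sum[OF N(2)] matrix_mul_sum_right mat_mult_left_commute ..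
  finally show ?thesis .
qed

lemma poly_mat_mult: "poly_mat (p * q) A = poly_mat p A ** poly_mat q A"
proof (induction p)
  case (pCons a p)
  have "poly_mat (pCons a p * q) A = mat a ** poly_mat q A + A ** (poly_mat p A ** poly_mat q A)"
    by (simp add: poly_mat_add poly_mat_smult poly_mat_pCons pCons.IH)
  also have "\<dots> = poly_mat (pCons a p) A ** poly_mat q A"
    by (simp add: poly_mat_pCons matrix_add_rdistrib matrix_mul_assoc)
  finally show ?case .
qed simp

lemma poly_mat_commute: "poly_mat p A ** poly_mat q A = poly_mat q A ** poly_mat p A"
  by (metis poly_mat_mult mult.commute)

lemma poly_mat_mult_vec:
  fixes A :: "'a::comm_ring_1^'n^'n"
  assumes "degree p < N"
  shows "poly_mat p A *v x = (\<Sum>i<N. coeff p i *s (mat_pow A i *v x))"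
  by (simp add: poly_mat_eq_sum[OF assms] matrix_vector_mult_sum_left
      matrix_vector_mul_assoc[symmetric] matrix_vector_mult_mat)

lemma poly_mat_monom_mult_vec: "poly_mat (monom c k) A *v x = c *s (mat_pow A k *v x)"
proof -
  have "degree (monom c k) < Suc k" by (simp add: degree_monom_le le_imp_less_Suc)
  thus ?thesis
    by (simp add: poly_mat_mult_vec coeff_monom if_distrib if_distribR sum.delta' cong: if_cong)
qed

lemma linear_poly_mat_mult_vec:
  fixes A B :: "'a::field^'n^'n"
  shows "Vector_Spaces.linear smult (*s) (\<lambda>Q. (poly_mat Q A ** B) *v x)"
  by (rule Vector_Spaces.linear_iff[THEN iffD2])
    (simp add: poly_vs.vector_space_axioms vec.vector_space_axioms poly_mat_add poly_mat_smult
      matrix_add_rdistrib matrix_vector_mult_add_rdistrib matrix_mul_assoc[symmetric]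
      matrix_vector_mul_assoc[symmetric] matrix_vector_mult_mat)

section \<open>Cyclic vectors\<close>

lemma cyclic_vectorD:
  fixes A :: "'a::field^'n^'n"
  assumes "cyclic_vector A x"
  shows "inj_on (\<lambda>i. mat_pow A i *v x) {..<CARD('n)}"
    and "vec.independent ((\<lambda>i. mat_pow A i *v x) ` {..<CARD('n)})"
    and "vec.span ((\<lambda>i. mat_pow A i *v x) ` {..<CARD('n)}) = UNIV"
  using assms unfolding cyclic_vector_def Let_def by (auto simp: inj_on_iff_eq_card)

lemma cyclic_vector_poly_mat_eq_0:
  fixes A :: "'a::field^'n^'n"
  assumes cyc: "cyclic_vector A x" and deg: "degree h < CARD('n)" and ann: "poly_mat h A *v x = 0"
  shows "h = 0"
proof -
  let ?b = "\<lambda>i. mat_pow A i *v x"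
  note inj = cyclic_vectorD(1)[OF cyc]
  define u where "u w = coeff h (the_inv_into {..<CARD('n)} ?b w)" for w
  have "(\<Sum>w\<in>?b ` {..<CARD('n)}. u w *s w) = (\<Sum>i<CARD('n). u (?b i) *s ?b i)"
    using inj by (simp add: sum.reindex)
  also have "\<dots> = (\<Sum>i<CARD('n). coeff h i *s ?b i)"
    by (rule sum.cong) (simp_all add: u_def the_inv_into_f_f[OF inj])
  also have "\<dots> = 0" using ann by (simp add: poly_mat_mult_vec[OF deg])
  finally have "\<forall>w\<in>?b ` {..<CARD('n)}. u w = 0"
    using cyclic_vectorD(2)[OF cyc] vec.dependent_finite[of "?b ` {..<CARD('n)}"] by blast
  hence "coeff h i = 0" if "i < CARD('n)" for i
    using that by (simp add: u_def the_inv_into_f_f[OF inj])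
  hence "coeff h i = 0" for i
    using deg by (cases "i < CARD('n)") (simp_all add: coeff_eq_0)
  thus ?thesis by (simp add: poly_eq_iff)
qed

lemma cyclic_vector_obtain_poly:
  fixes A :: "'a::field^'n^'n"
  assumes cyc: "cyclic_vector A x"
  obtains h where "degree h < CARD('n)" and "w = poly_mat h A *v x"
proof -
  let ?b = "\<lambda>i. mat_pow A i *v x"
  have "w \<in> vec.span (?b ` {..<CARD('n)})" using cyclic_vectorD(3)[OF cyc] by simp
  then obtain u where u: "w = (\<Sum>v\<in>?b ` {..<CARD('n)}. u v *s v)"
    using vec.span_finite[of "?b ` {..<CARD('n)}"] by auto
  define h where "h = Poly (map (\<lambda>i. u (?b i)) [0..<CARD('n)])"
  have coeff_h: "coeff h i = (if i < CARD('n) then u (?b i) else 0)" for i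
    unfolding h_def by (simp add: nth_default_def)
  have "degree h \<le> CARD('n) - 1" by (rule degree_le) (auto simp: coeff_h)
  hence deg: "degree h < CARD('n)" using zero_less_card_finite[where 'a='n] by linarith
  have "w = (\<Sum>i<CARD('n). coeff h i *s ?b i)"
    unfolding u using cyclic_vectorD(1)[OF cyc] by (simp add: sum.reindex coeff_h)
  also have "\<dots> = poly_mat h A *v x" by (simp add: poly_mat_mult_vec[OF deg])
  finally show ?thesis using deg that by blast
qed

lemma cyclic_vector_annihilates_all:
  fixes A :: "'a::field^'n^'n"
  assumes cyc: "cyclic_vector A x" and ann: "poly_mat p A *v x = 0"
  shows "poly_mat p A = 0"
proof (rule matrix_eq[THEN iffD2], intro allI)
  fix y :: "'a^'n"
  obtain h where y: "y = poly_mat h A *v x" using cyclic_vector_obtain_poly[OF cyc] by blast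
  have "poly_mat p A *v y = poly_mat h A *v (poly_mat p A *v x)"
    by (simp add: y matrix_vector_mul_assoc poly_mat_commute)
  thus "poly_mat p A *v y = 0 *v y" by (simp add: ann)
qed

lemma cyclic_vector_annihilator_dvd:
  fixes A :: "'a::field^'n^'n"
  assumes cyc: "cyclic_vector A x" and f: "poly_mat f A = 0" "degree f = CARD('n)"
    and ann: "poly_mat p A *v x = 0"
  shows "f dvd p"
proof -
  have "poly_mat p A = poly_mat (p div f) A ** poly_mat f A + poly_mat (p mod f) A"
    by (metis div_mult_mod_eq poly_mat_add poly_mat_mult)
  hence "poly_mat (p mod f) A *v x = 0" using ann f(1) by simp
  moreover have "f \<noteq> 0" using f(2) by auto
  hence "p mod f = 0 \<or> degree (p mod f) < CARD('n)" using degree_mod_less f(2) by metis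
  ultimately have "p mod f = 0" using cyclic_vector_poly_mat_eq_0[OF cyc] by blast
  thus ?thesis by (simp add: mod_eq_0_iff_dvd)
qed

lemma degree_min_poly_cyclic:
  fixes A :: "'a::field^'n^'n"
  assumes minp: "is_min_poly A f" and cyc: "cyclic_vector A x"
  shows "degree f = CARD('n)"
proof (rule antisym)
  have f: "f \<noteq> 0" "poly_mat f A = 0" "\<And>p. poly_mat p A = 0 \<Longrightarrow> f dvd p"
    using minp unfolding is_min_poly_def by auto
  obtain h where h: "degree h < CARD('n)" "mat_pow A CARD('n) *v x = poly_mat h A *v x"
    using cyclic_vector_obtain_poly[OF cyc] by blast
  define q where "q = monom 1 CARD('n) - h"
  have "poly_mat q A *v x = 0"
    using h(2)
    by (simp add: q_def poly_mat_diff matrix_vector_mult_diff_rdistrib poly_mat_monom_mult_vec)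
  hence "f dvd q" using f(3) cyclic_vector_annihilates_all[OF cyc] by blast
  moreover have "degree q = CARD('n)"
    unfolding q_def diff_conv_add_uminus using h(1)
    by (subst degree_add_eq_left) (simp_all add: degree_monom_eq)
  ultimately show "degree f \<le> CARD('n)"
    by (metis dvd_imp_degree_le degree_0 zero_less_card_finite less_irrefl)
  show "CARD('n) \<le> degree f"
  proof (rule ccontr)
    assume "\<not> CARD('n) \<le> degree f"
    hence "f = 0" using cyclic_vector_poly_mat_eq_0[OF cyc, of f] f(2) by simp
    with f(1) show False ..
  qed
qed

lemma inj_on_poly_mat_mult_cyclic:
  fixes A :: "'a::field^'n^'n"
  assumes cyc: "cyclic_vector A x" and F: "F \<noteq> 0"
  shows "inj_on (\<lambda>Q. (poly_mat Q A ** poly_mat F A) *v x)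
           {Q. Q = 0 \<or> degree Q < CARD('n) - degree F}"
proof (rule inj_onI)
  fix Q1 Q2
  assume "Q1 \<in> {Q. Q = 0 \<or> degree Q < CARD('n) - degree F}"
    and "Q2 \<in> {Q. Q = 0 \<or> degree Q < CARD('n) - degree F}"
    and eq: "(poly_mat Q1 A ** poly_mat F A) *v x = (poly_mat Q2 A ** poly_mat F A) *v x"
  hence deg: "Q1 - Q2 = 0 \<or> degree (Q1 - Q2) < CARD('n) - degree F"
    by (auto intro: degree_diff_less)
  have ann: "poly_mat ((Q1 - Q2) * F) A *v x = 0"
    using eq
    by (simp add: left_diff_distrib poly_mat_diff poly_mat_mult matrix_vector_mult_diff_rdistrib)
  have "(Q1 - Q2) * F = 0"
  proof (cases "Q1 - Q2 = 0")
    case False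
    hence "degree ((Q1 - Q2) * F) < CARD('n)" using deg F by (simp add: degree_mult_eq)
    thus ?thesis using cyclic_vector_poly_mat_eq_0[OF cyc _ ann] by blast
  qed simp
  thus "Q1 = Q2" using F by simp
qed

section \<open>Field embeddings and divisibility\<close>

locale field_embedding =
  fixes emb :: "'k::field \<Rightarrow> 'l::field"
  assumes is_field_emb: "is_field_emb emb"
begin

lemma emb_add: "emb (a + b) = emb a + emb b"
  and emb_mult: "emb (a * b) = emb a * emb b"
  and emb_1: "emb 1 = 1"
  and emb_eq_iff: "emb a = emb b \<longleftrightarrow> a = b"
  using is_field_emb unfolding is_field_emb_def inj_def by blast+

lemma emb_0: "emb 0 = 0"
  using emb_add[of 0 0] by (metis add_cancel_right_right add_0)

lemma emb_eq_0_iff: "emb a = 0 \<longleftrightarrow> a = 0"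
  using emb_eq_iff[of a 0] by (simp add: emb_0)

lemma emb_sum: "emb (\<Sum>i\<in>A. f i) = (\<Sum>i\<in>A. emb (f i))"
  by (induction A rule: infinite_finite_induct) (auto simp: emb_0 emb_add)

lemma map_poly_add: "map_poly emb (p + q) = map_poly emb p + map_poly emb q"
  by (intro poly_eqI) (simp add: coeff_map_poly emb_0 emb_add)

lemma map_poly_mult: "map_poly emb (p * q) = map_poly emb p * map_poly emb q"
proof (induction p)
  case (pCons a p)
  have "map_poly emb (pCons a p * q) = map_poly emb (smult a q + pCons 0 (p * q))" by simp
  also have "\<dots> = smult (emb a) (map_poly emb q) + pCons 0 (map_poly emb p * map_poly emb q)"
    by (simp add: map_poly_add map_poly_smult map_poly_pCons emb_0 emb_mult pCons.IH)
  also have "\<dots> = map_poly emb (pCons a p) * map_poly emb q"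
    by (simp add: map_poly_pCons emb_0)
  finally show ?case .
qed simp

lemma map_poly_power: "map_poly emb (p ^ k) = map_poly emb p ^ k"
  by (induction k) (simp_all add: emb_1 map_poly_mult)

lemma map_poly_dvd: "p dvd q \<Longrightarrow> map_poly emb p dvd map_poly emb q"
  by (metis dvd_def map_poly_mult)

lemma degree_map_poly_emb: "degree (map_poly emb p) = degree p"
  by (rule degree_map_poly) (simp add: emb_eq_0_iff)

lemma comaximal_map_poly: "comaximal p q \<Longrightarrow> comaximal (map_poly emb p) (map_poly emb q)"
  by (rule comaximal_hom) (simp_all add: map_poly_add map_poly_mult emb_1)

lemma dvd_map_poly_iff_power_dvd:
  fixes p :: "'k poly" and q :: "'l poly"
  assumes irr: "irreducible p" and dvd_m: "q dvd map_poly emb (p ^ m)"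
    and dvd_l: "q dvd map_poly emb p ^ l"
    and least: "\<And>k. q dvd map_poly emb p ^ k \<Longrightarrow> l \<le> k"
  shows "q dvd map_poly emb h \<longleftrightarrow> p ^ l dvd h"
proof
  assume "p ^ l dvd h"
  thus "q dvd map_poly emb h" using dvd_l map_poly_dvd by (metis dvd_trans map_poly_power)
next
  assume q_dvd: "q dvd map_poly emb h"
  show "p ^ l dvd h"
  proof (cases "h = 0")
    case False
    then obtain k r where h: "h = p ^ k * r" and r: "\<not> p dvd r"
      using irreducible_power_cofactorE[OF irr] by metis
    have "comaximal (p ^ m) r"
      using coprime_imp_comaximal_poly[OF irreducible_not_dvd_imp_coprime[OF irr r]]
      by (rule comaximal_power_left)
    hence "comaximal q (map_poly emb r)"
      using comaximal_divisors[OF comaximal_map_poly dvd_m dvd_refl] by blast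
    moreover have "q dvd map_poly emb p ^ k * map_poly emb r"
      using q_dvd by (simp add: h map_poly_mult map_poly_power)
    ultimately have "q dvd map_poly emb p ^ k" by (rule comaximal_dvd_mult_right)
    hence "p ^ l dvd p ^ k" using least by (simp add: le_imp_power_dvd)
    thus ?thesis unfolding h by (rule dvd_mult2)
  qed simp
qed

lemma comaximal_monic_irreducible_powers:
  fixes p q :: "'k poly"
  assumes "irreducible p" "irreducible q" "lead_coeff p = 1" "lead_coeff q = 1" "p \<noteq> q"
  shows "comaximal (p ^ a) (q ^ b)"
proof -
  have "\<not> p dvd q" using monic_irreducible_dvd_imp_eq assms by blast
  thus ?thesis
    using assms(1)
    by (intro comaximal_power coprime_imp_comaximal_poly irreducible_not_dvd_imp_coprime)
qed

lemma dvd_map_poly_iff_prod_power_dvd: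
  fixes fs :: "nat \<Rightarrow> 'k poly" and gs :: "nat \<Rightarrow> 'l poly"
  assumes fs_irr: "\<And>i. i < s \<Longrightarrow> lead_coeff (fs i) = 1 \<and> irreducible (fs i)"
    and fs_dist: "\<And>i j. i < s \<Longrightarrow> j < s \<Longrightarrow> i \<noteq> j \<Longrightarrow> fs i \<noteq> fs j"
    and gs_dvd: "\<And>i. i < s \<Longrightarrow> gs i dvd map_poly emb (fs i ^ ms i)"
    and gs_dvd_l: "\<And>i. i < s \<Longrightarrow> gs i dvd map_poly emb (fs i) ^ l i"
    and l_least: "\<And>i k. i < s \<Longrightarrow> gs i dvd map_poly emb (fs i) ^ k \<Longrightarrow> l i \<le> k"
  shows "(\<Prod>i<s. gs i) dvd map_poly emb h \<longleftrightarrow> (\<Prod>i<s. fs i ^ l i) dvd h"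
proof -
  have fs_comax: "comaximal (fs i ^ a) (fs j ^ b)" if "i < s" "j < s" "i \<noteq> j" for i j a b
    using comaximal_monic_irreducible_powers fs_irr[OF that(1)] fs_irr[OF that(2)] fs_dist[OF that]
    by blast
  have gs_comax: "comaximal (gs i) (gs j)" if "i < s" "j < s" "i \<noteq> j" for i j
    using comaximal_divisors[OF comaximal_map_poly[OF fs_comax[OF that]]] gs_dvd that by blast
  have "(\<Prod>i<s. gs i) dvd map_poly emb h \<longleftrightarrow> (\<forall>i<s. gs i dvd map_poly emb h)"
    using gs_comax by (rule prod_dvd_iff_pairwise_comaximal)
  also have "\<dots> \<longleftrightarrow> (\<forall>i<s. fs i ^ l i dvd h)"
    using dvd_map_poly_iff_power_dvd fs_irr gs_dvd gs_dvd_l l_least by blast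
  also have "\<dots> \<longleftrightarrow> (\<Prod>i<s. fs i ^ l i) dvd h"
    using fs_comax by (intro prod_dvd_iff_pairwise_comaximal[symmetric])
  finally show ?thesis .
qed

end

section \<open>Extension of scalars for matrices and vectors\<close>

context field_embedding
begin

lemma map_matrix_mult: "map_matrix emb (A ** B) = map_matrix emb A ** map_matrix emb B"
  by (simp add: vec_eq_iff map_matrix_def matrix_matrix_mult_def emb_sum emb_mult)

lemma map_matrix_add: "map_matrix emb (A + B) = map_matrix emb A + map_matrix emb B"
  by (simp add: vec_eq_iff map_matrix_def emb_add)

lemma map_matrix_0: "map_matrix emb 0 = 0"
  by (simp add: vec_eq_iff map_matrix_def emb_0)

lemma map_matrix_mat: "map_matrix emb (mat c) = mat (emb c)"
  by (simp add: vec_eq_iff map_matrix_def mat_def emb_0)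

lemma map_matrix_sum: "map_matrix emb (\<Sum>i\<in>S. f i) = (\<Sum>i\<in>S. map_matrix emb (f i))"
  by (induction S rule: infinite_finite_induct) (auto simp: map_matrix_0 map_matrix_add)

lemma map_matrix_mat_pow: "map_matrix emb (mat_pow A k) = mat_pow (map_matrix emb A) k"
  by (induction k) (simp_all add: map_matrix_mat emb_1 map_matrix_mult)

lemma map_matrix_poly_mat:
  "map_matrix emb (poly_mat p A) = poly_mat (map_poly emb p) (map_matrix emb A)"
proof -
  have N: "degree p < Suc (degree p)" "degree (map_poly emb p) < Suc (degree p)"
    by (simp_all add: degree_map_poly_emb)
  show ?thesis
    unfolding poly_mat_eq_sum[OF N(1)] poly_mat_eq_sum[OF N(2)] map_matrix_sum map_matrix_mult
      map_matrix_mat map_matrix_mat_pow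
    by (simp add: coeff_map_poly emb_0)
qed

lemma map_vector_mult: "map_vector emb (A *v x) = map_matrix emb A *v map_vector emb x"
  by (simp add: vec_eq_iff map_matrix_def map_vector_def matrix_vector_mult_def emb_sum emb_mult)

lemma map_vector_scale: "map_vector emb (c *s x) = emb c *s map_vector emb x"
  by (simp add: vec_eq_iff map_vector_def emb_mult)

lemma map_vector_sum: "map_vector emb (\<Sum>i\<in>S. f i) = (\<Sum>i\<in>S. map_vector emb (f i))"
  by (induction S rule: infinite_finite_induct)
    (auto simp: vec_eq_iff map_vector_def emb_0 emb_add)

lemma map_vector_eq_iff: "map_vector emb x = map_vector emb y \<longleftrightarrow> x = y"
  by (simp add: vec_eq_iff map_vector_def emb_eq_iff)

lemma map_vector_eq_0_iff: "map_vector emb x = 0 \<longleftrightarrow> x = 0"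
  using map_vector_eq_iff[of x 0] by (simp add: vec_eq_iff map_vector_def emb_0)

lemma map_vector_poly_mat:
  "map_vector emb (poly_mat p A *v x)
    = poly_mat (map_poly emb p) (map_matrix emb A) *v map_vector emb x"
  by (simp add: map_vector_mult map_matrix_poly_mat)

lemma cyclic_vector_map:
  fixes M :: "'k^'n^'n"
  assumes cyc: "cyclic_vector M v"
  shows "cyclic_vector (map_matrix emb M) (map_vector emb v)"
proof -
  define B where "B = (\<lambda>i. mat_pow M i *v v) ` {..<CARD('n)}"
  have B_map: "(\<lambda>i. mat_pow (map_matrix emb M) i *v map_vector emb v) ` {..<CARD('n)}
      = map_vector emb ` B"
    unfolding B_def image_image by (simp add: map_vector_mult map_matrix_mat_pow)
  have "inj_on (map_vector emb) B" by (simp add: inj_on_def map_vector_eq_iff)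
  hence card: "card (map_vector emb ` B) = CARD('n)"
    using cyc unfolding cyclic_vector_def Let_def B_def by (simp add: card_image)
  have "axis j 1 \<in> vec.span (map_vector emb ` B)" for j
  proof -
    have "axis j (1::'k) \<in> vec.span B" using cyc unfolding cyclic_vector_def Let_def B_def by simp
    then obtain u where u: "axis j (1::'k) = (\<Sum>w\<in>B. u w *s w)"
      using vec.span_finite[of B] by (auto simp: B_def)
    have "axis j (1::'l) = map_vector emb (axis j 1)"
      by (simp add: vec_eq_iff map_vector_def axis_def emb_0 emb_1)
    also have "\<dots> = (\<Sum>w\<in>B. emb (u w) *s map_vector emb w)"
      unfolding u by (simp add: map_vector_sum map_vector_scale)
    also have "\<dots> \<in> vec.span (map_vector emb ` B)"
      by (intro vec.span_sum vec.span_scale vec.span_base imageI)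
    finally show ?thesis .
  qed
  hence "cart_basis \<subseteq> vec.span (map_vector emb ` B)" by (auto simp: cart_basis_def)
  hence span: "vec.span (map_vector emb ` B) = UNIV"
    by (metis span_cart_basis top.extremum_uniqueI vec.span_minimal vec.subspace_span)
  have "vec.independent (map_vector emb ` B)"
    using vec.card_le_dim_spanning[of "map_vector emb ` B" UNIV] span card
    by (simp add: B_def vec_dim_card card_cart_basis)
  thus ?thesis unfolding cyclic_vector_def Let_def B_map using card span by simp
qed

end

section \<open>Rank weights\<close>

context field_embedding
begin

lemma vector_space_ext_scale: "vector_space (ext_scale emb)"
  by unfold_locales (simp_all add: ext_scale_def emb_add emb_mult emb_1 algebra_simps)

lemma rank_weight_pos:
  fixes c :: "'l^'n"
  assumes "c \<noteq> 0" shows "0 < rank_weight emb c"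
proof -
  interpret E: vector_space "ext_scale emb" by (rule vector_space_ext_scale)
  define V where "V = E.span (range (\<lambda>i. c $ i))"
  obtain B where B: "B \<subseteq> V" "E.independent B" "V \<subseteq> E.span B" "card B = E.dim V"
    using E.basis_exists by blast
  have "finite B"
    using E.independent_span_bound[of "range (\<lambda>i. c $ i)" B] B(1,2) unfolding V_def by auto
  moreover obtain j where "c $ j \<noteq> 0" using assms by (auto simp: vec_eq_iff)
  hence "B \<noteq> {}"
    using B(3) E.span_base[of "c $ j" "range (\<lambda>i. c $ i)"] unfolding V_def by auto
  ultimately have "0 < card B" by (simp add: card_gt_0_iff)
  thus ?thesis using B(4) by (simp add: rank_weight_def V_def)
qed

lemma rank_weight_le: "rank_weight emb (c :: 'l^'n) \<le> CARD('n)"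
proof -
  interpret E: vector_space "ext_scale emb" by (rule vector_space_ext_scale)
  have "E.dim (E.span (range (\<lambda>i. c $ i))) \<le> card (range (\<lambda>i. c $ i))"
    by (rule E.dim_le_card) auto
  also have "\<dots> \<le> CARD('n)" by (rule card_image_le) simp
  finally show ?thesis unfolding rank_weight_def .
qed

lemma rank_weight_eq_1_iff:
  fixes c :: "'l^'n"
  assumes "c \<noteq> 0"
  shows "rank_weight emb c = 1 \<longleftrightarrow> (\<exists>b w. b \<noteq> 0 \<and> c = b *s map_vector emb w)"
proof -
  interpret E: vector_space "ext_scale emb" by (rule vector_space_ext_scale)
  define V where "V = E.span (range (\<lambda>i. c $ i))"
  show ?thesis
  proof
    assume "rank_weight emb c = 1"
    obtain B where B: "B \<subseteq> V" "E.independent B" "V \<subseteq> E.span B" "card B = E.dim V"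
      using E.basis_exists by blast
    have "card B = 1"
      using \<open>rank_weight emb c = 1\<close> B(4) unfolding rank_weight_def V_def by simp
    then obtain b where b: "B = {b}" by (rule card_1_singletonE)
    have "\<forall>i. \<exists>a. c $ i = emb a * b"
    proof
      fix i
      have "c $ i \<in> E.span {b}" using B(3) E.span_base[of "c $ i"] b unfolding V_def by auto
      thus "\<exists>a. c $ i = emb a * b" by (auto simp: E.span_singleton ext_scale_def)
    qed
    then obtain a where "\<forall>i. c $ i = emb (a i) * b" by metis
    hence "c = b *s map_vector emb (\<chi> i. a i)" by (simp add: vec_eq_iff map_vector_def)
    moreover have "b \<noteq> 0" using B(2) E.dependent_zero b by blast
    ultimately show "\<exists>b w. b \<noteq> 0 \<and> c = b *s map_vector emb w" by blast
  next
    assume "\<exists>b w. b \<noteq> 0 \<and> c = b *s map_vector emb w"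
    then obtain b w where c: "c = b *s map_vector emb w" by blast
    have "c $ i \<in> E.span {b}" for i
    proof -
      have "c $ i = ext_scale emb (w $ i) b"
        by (simp add: c map_vector_def ext_scale_def mult.commute)
      thus ?thesis using E.span_scale[OF E.span_base[of b "{b}"]] by simp
    qed
    hence "range (\<lambda>i. c $ i) \<subseteq> E.span {b}" by blast
    hence "E.span (range (\<lambda>i. c $ i)) \<subseteq> E.span {b}"
      by (rule E.span_minimal[OF _ E.subspace_span])
    hence "rank_weight emb c \<le> card {b}"
      unfolding rank_weight_def by (rule E.dim_le_card) simp
    thus "rank_weight emb c = 1" using rank_weight_pos[OF assms] by simp
  qed
qed

lemma first_gen_rank_weight_eq_1_iff:
  fixes C :: "('l^'n) set"
  assumes scale: "\<And>b c. c \<in> C \<Longrightarrow> b *s c \<in> C" and nonzero: "\<exists>c\<in>C. c \<noteq> 0"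
  shows "first_gen_rank_weight emb C = 1 \<longleftrightarrow> (\<exists>w. w \<noteq> 0 \<and> map_vector emb w \<in> C)"
proof -
  define W where "W = rank_weight emb ` (C - {0})"
  have fin: "finite W"
    by (rule finite_subset[of _ "{..CARD('n)}"]) (auto simp: W_def rank_weight_le)
  have ne: "W \<noteq> {}" using nonzero by (auto simp: W_def)
  have pos: "0 < Min W"
  proof -
    have "Min W \<in> W" by (rule Min_in[OF fin ne])
    then obtain c where "Min W = rank_weight emb c" "c \<in> C - {0}"
      unfolding W_def by (rule imageE)
    thus ?thesis using rank_weight_pos[of c] by simp
  qed
  have "first_gen_rank_weight emb C = Min W"
    unfolding first_gen_rank_weight_def W_def by (rule arg_cong[where f = Min]) auto
  also have "\<dots> = 1 \<longleftrightarrow> 1 \<in> W"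
  proof
    assume "1 \<in> W"
    thus "Min W = 1" using Min_le[OF fin] pos by (metis One_nat_def Suc_leI le_antisym)
  qed (use Min_in[OF fin ne] in simp)
  also have "\<dots> \<longleftrightarrow> (\<exists>w. w \<noteq> 0 \<and> map_vector emb w \<in> C)"
  proof
    assume "1 \<in> W"
    then obtain c where "1 = rank_weight emb c" "c \<in> C - {0}" unfolding W_def by (rule imageE)
    hence c: "c \<in> C" "c \<noteq> 0" "rank_weight emb c = 1" by auto
    then obtain b w where b: "b \<noteq> 0" and cw: "c = b *s map_vector emb w"
      using rank_weight_eq_1_iff[OF c(2)] c(3) by blast
    have "map_vector emb w = inverse b *s c" using b by (simp add: cw)
    hence "map_vector emb w \<in> C" using scale c(1) by simp
    moreover have "w \<noteq> 0" using c(2) by (auto simp: cw map_vector_eq_0_iff)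
    ultimately show "\<exists>w. w \<noteq> 0 \<and> map_vector emb w \<in> C" by blast
  next
    assume "\<exists>w. w \<noteq> 0 \<and> map_vector emb w \<in> C"
    then obtain w where w: "w \<noteq> 0" "map_vector emb w \<in> C" by blast
    hence nz: "map_vector emb w \<noteq> 0" by (simp add: map_vector_eq_0_iff)
    have "\<exists>b w'. b \<noteq> 0 \<and> map_vector emb w = b *s map_vector emb w'"
      by (rule exI[of _ 1], rule exI[of _ w]) simp
    hence "rank_weight emb (map_vector emb w) = 1" using rank_weight_eq_1_iff[OF nz] by blast
    thus "1 \<in> W"
      unfolding W_def using w(2) nz by (intro rev_image_eqI[of "map_vector emb w"]) auto
  qed
  finally show ?thesis by simp
qed

end

section \<open>Cyclic codes\<close>

lemma zero_mem_cyclic_code: "0 \<in> cyclic_code emb M v g"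
  unfolding cyclic_code_def by (rule CollectI, rule exI[of _ 0]) simp

lemma scale_mem_cyclic_code:
  assumes "c \<in> cyclic_code emb M v g" shows "b *s c \<in> cyclic_code emb M v g"
proof -
  obtain P
    where "c = (poly_mat P (map_matrix emb M) ** poly_mat g (map_matrix emb M)) *v map_vector emb v"
    using assms unfolding cyclic_code_def by blast
  hence "b *s c
      = (poly_mat (smult b P) (map_matrix emb M) ** poly_mat g (map_matrix emb M)) *v map_vector emb v"
    by (simp add: poly_mat_smult matrix_vector_mult_mat[symmetric] matrix_vector_mul_assoc
        matrix_mul_assoc)
  thus ?thesis unfolding cyclic_code_def by blast
qed

context field_embedding
begin

lemma base_field_cyclic_code_eq_image:
  fixes M :: "'k^'n^'n"
  assumes minp: "is_min_poly M f" and cyc: "cyclic_vector M v" and g_dvd: "g dvd map_poly emb f"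
    and F_iff: "\<And>h. g dvd map_poly emb h \<longleftrightarrow> F dvd h"
  shows "{w. map_vector emb w \<in> cyclic_code emb M v g}
    = (\<lambda>Q. (poly_mat Q M ** poly_mat F M) *v v) ` {Q. Q = 0 \<or> degree Q < CARD('n) - degree F}"
    (is "?S = ?\<phi> ` ?D")
proof
  show "?\<phi> ` ?D \<subseteq> ?S"
  proof clarify
    fix Q :: "'k poly"
    obtain r where r: "map_poly emb F = g * r" using F_iff[of F] by (auto elim: dvdE)
    have "map_vector emb (?\<phi> Q)
        = poly_mat (map_poly emb (Q * F)) (map_matrix emb M) *v map_vector emb v"
      by (simp add: poly_mat_mult[symmetric] map_vector_poly_mat)
    also have "\<dots> = (poly_mat (map_poly emb Q * r) (map_matrix emb M) ** poly_mat g (map_matrix emb M))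
        *v map_vector emb v"
      by (simp add: map_poly_mult r poly_mat_mult[symmetric] ac_simps)
    finally show "map_vector emb (?\<phi> Q) \<in> cyclic_code emb M v g"
      unfolding cyclic_code_def by blast
  qed
next
  show "?S \<subseteq> ?\<phi> ` ?D"
  proof
    fix w assume "w \<in> ?S"
    then obtain P where P: "map_vector emb w
        = (poly_mat P (map_matrix emb M) ** poly_mat g (map_matrix emb M)) *v map_vector emb v"
      unfolding cyclic_code_def by blast
    obtain h where h: "degree h < CARD('n)" "w = poly_mat h M *v v"
      using cyclic_vector_obtain_poly[OF cyc] by blast
    have "poly_mat (map_poly emb h - P * g) (map_matrix emb M) *v map_vector emb v = 0"
      using P by (simp add: h map_vector_poly_mat poly_mat_diff poly_mat_mult
          matrix_vector_mult_diff_rdistrib)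
    moreover have "poly_mat (map_poly emb f) (map_matrix emb M) = 0"
      using minp by (simp add: is_min_poly_def map_matrix_poly_mat[symmetric] map_matrix_0)
    moreover have "degree (map_poly emb f) = CARD('n)"
      using degree_min_poly_cyclic[OF minp cyc] by (simp add: degree_map_poly_emb)
    ultimately have "map_poly emb f dvd map_poly emb h - P * g"
      using cyclic_vector_annihilator_dvd[OF cyclic_vector_map[OF cyc]] by blast
    hence "g dvd map_poly emb h - P * g + P * g" using g_dvd dvd_trans by (intro dvd_add) auto
    hence "F dvd h" using F_iff by simp
    then obtain Q where Q: "h = F * Q" by (elim dvdE)
    have "F \<noteq> 0" using F_iff[of f] g_dvd minp by (auto simp: is_min_poly_def)
    hence "Q \<in> ?D" using h(1) by (cases "Q = 0") (auto simp: Q degree_mult_eq)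
    moreover have "w = ?\<phi> Q" by (simp add: h(2) Q poly_mat_mult poly_mat_commute)
    ultimately show "w \<in> ?\<phi> ` ?D" by blast
  qed
qed

lemma base_field_cyclic_code:
  fixes M :: "'k^'n^'n"
  assumes minp: "is_min_poly M f" and cyc: "cyclic_vector M v" and g_dvd: "g dvd map_poly emb f"
    and F_iff: "\<And>h. g dvd map_poly emb h \<longleftrightarrow> F dvd h"
  defines "\<phi> \<equiv> \<lambda>Q. (poly_mat Q M ** poly_mat F M) *v v"
    and "D \<equiv> {Q. Q = 0 \<or> degree Q < CARD('n) - degree F}"
    and "S \<equiv> {w. map_vector emb w \<in> cyclic_code emb M v g}"
  shows "bij_betw \<phi> D S"
    and "vec.dim S = CARD('n) - degree F"
    and "cyclic_code emb M v g \<noteq> {0} \<Longrightarrow>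
          first_gen_rank_weight emb (cyclic_code emb M v g) = 1 \<longleftrightarrow> degree F < CARD('n)"
proof -
  have "F \<noteq> 0" using F_iff[of f] g_dvd minp by (auto simp: is_min_poly_def)
  hence inj: "inj_on \<phi> D"
    unfolding \<phi>_def D_def by (rule inj_on_poly_mat_mult_cyclic[OF cyc])
  have S: "S = \<phi> ` D"
    unfolding S_def \<phi>_def D_def by (rule base_field_cyclic_code_eq_image[OF minp cyc g_dvd F_iff])
  show "bij_betw \<phi> D S" using inj S by (simp add: bij_betw_def)
  show "vec.dim S = CARD('n) - degree F"
    using inj unfolding S \<phi>_def D_def by (intro dim_image_degree_less linear_poly_mat_mult_vec)
  assume "cyclic_code emb M v g \<noteq> {0}"
  hence "\<exists>c\<in>cyclic_code emb M v g. c \<noteq> 0" using zero_mem_cyclic_code by blast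
  hence "first_gen_rank_weight emb (cyclic_code emb M v g) = 1 \<longleftrightarrow> (\<exists>w\<in>S. w \<noteq> 0)"
    unfolding S_def using scale_mem_cyclic_code by (subst first_gen_rank_weight_eq_1_iff) auto
  also have "\<dots> \<longleftrightarrow> (\<exists>Q\<in>D. Q \<noteq> 0)"
    unfolding S using inj by (rule inj_on_image_ex_nonzero_iff) (simp_all add: D_def \<phi>_def)
  finally show "first_gen_rank_weight emb (cyclic_code emb M v g) = 1 \<longleftrightarrow> degree F < CARD('n)"
    unfolding D_def ex_nonzero_degree_less_iff by simp
qed

end

theorem theorem4:
  fixes emb :: "'k::field \<Rightarrow> 'l::field"
    and M :: "'k^'n^'n"
    and f :: "'k poly" and s :: nat and fs :: "nat \<Rightarrow> 'k poly" and ms :: "nat \<Rightarrow> nat"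
    and g :: "'l poly" and gs :: "nat \<Rightarrow> 'l poly"
    and l :: "nat \<Rightarrow> nat" and d :: nat and v :: "'k^'n"
  assumes ext: "is_field_emb emb" and fin: "finite_degree emb"
    and deg: "ext_degree emb \<ge> CARD('n)"
    and cyc: "cyclic_matrix M"
    and minp: "is_min_poly M f"
    and f_fact: "f = (\<Prod>i<s. fs i ^ ms i)"
    and fs_irr: "\<And>i. i < s \<Longrightarrow> lead_coeff (fs i) = 1 \<and> irreducible (fs i)"
    and fs_dist: "\<And>i j. i < s \<Longrightarrow> j < s \<Longrightarrow> i \<noteq> j \<Longrightarrow> fs i \<noteq> fs j"
    and ms_pos: "\<And>i. i < s \<Longrightarrow> ms i \<ge> 1"
    and g_monic: "lead_coeff g = 1" and g_dvd: "g dvd map_poly emb f"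
    and g_fact: "g = (\<Prod>i<s. gs i)"
    and gs_monic: "\<And>i. i < s \<Longrightarrow> lead_coeff (gs i) = 1"
    and gs_dvd: "\<And>i. i < s \<Longrightarrow> gs i dvd map_poly emb (fs i ^ ms i)"
    and l_def: "\<And>i. i < s \<Longrightarrow> l i = (if gs i = 1 then 0
                  else (LEAST k. 1 \<le> k \<and> k \<le> ms i \<and> gs i dvd map_poly emb (fs i ^ k)))"
    and d_def: "d = CARD('n) - (\<Sum>i<s. l i * degree (fs i))"
    and v_cyc: "cyclic_vector M v"
  shows "(\<forall>h :: 'k poly. g dvd map_poly emb h \<longleftrightarrow> (\<Prod>i<s. fs i ^ l i) dvd h)
     \<and> Vector_Spaces.linear smult (*s)
         (\<lambda>Q :: 'k poly. (poly_mat Q M ** poly_mat (\<Prod>i<s. fs i ^ l i) M) *v v)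
     \<and> bij_betw (\<lambda>Q :: 'k poly. (poly_mat Q M ** poly_mat (\<Prod>i<s. fs i ^ l i) M) *v v)
         {Q. Q = 0 \<or> degree Q < d}
         {w. map_vector emb w \<in> cyclic_code emb M v g}
     \<and> vec.dim {w. map_vector emb w \<in> cyclic_code emb M v g}
         = (\<Sum>i<s. (ms i - l i) * degree (fs i))
     \<and> (cyclic_code emb M v g \<noteq> {0} \<longrightarrow>
         (first_gen_rank_weight emb (cyclic_code emb M v g) = 1 \<longleftrightarrow> (\<exists>i<s. l i \<le> ms i - 1)))"
proof -
  interpret field_embedding emb using ext by (rule field_embedding.intro)
  define F where "F = (\<Prod>i<s. fs i ^ l i)"
  note l = least_exponent_dvd_power[OF gs_monic gs_dvd[unfolded map_poly_power] ms_pos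
      l_def[unfolded map_poly_power]]
  have F_iff: "g dvd map_poly emb h \<longleftrightarrow> F dvd h" for h
    unfolding F_def g_fact using fs_irr fs_dist gs_dvd l(2,3)
    by (intro dvd_map_poly_iff_prod_power_dvd) auto
  have deg_prod: "degree (\<Prod>i<s. fs i ^ e i) = (\<Sum>i<s. e i * degree (fs i))" for e
    using fs_irr by (intro degree_prod_powers) (auto simp: irreducible_def)
  have "CARD('n) = (\<Sum>i<s. ms i * degree (fs i))"
    using degree_min_poly_cyclic[OF minp v_cyc] by (simp add: f_fact deg_prod)
  moreover have "(\<Sum>i<s. (ms i - l i) * degree (fs i))
      = (\<Sum>i<s. ms i * degree (fs i)) - (\<Sum>i<s. l i * degree (fs i))"
    using l(1) by (intro sum_diff_mult_nat) auto
  ultimately have d: "d = CARD('n) - degree F" "d = (\<Sum>i<s. (ms i - l i) * degree (fs i))"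
    by (simp_all add: d_def F_def deg_prod)
  have "degree F < CARD('n) \<longleftrightarrow> 0 < d" by (simp add: d(1))
  also have "\<dots> \<longleftrightarrow> (\<exists>i\<in>{..<s}. l i < ms i)"
    unfolding d(2) using fs_irr irreducible_degree_pos by (intro sum_diff_mult_pos_iff) auto
  also have "\<dots> \<longleftrightarrow> (\<exists>i<s. l i \<le> ms i - 1)"
    using ms_pos by (auto simp: le_diff_conv2 Suc_le_eq)
  finally have deg_F_iff: "degree F < CARD('n) \<longleftrightarrow> (\<exists>i<s. l i \<le> ms i - 1)" .
  show ?thesis
    using F_iff linear_poly_mat_mult_vec base_field_cyclic_code[OF minp v_cyc g_dvd F_iff]
    unfolding F_def[symmetric] d(2)[symmetric] d(1) deg_F_iff[symmetric] by simp
qed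

end
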